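(* Let $H=(V,E)$ be a directed $m$-uniform hypergraph. Let $L_H=L_H^++L_H^-$ and $\mathbb L_H=\mathbb L_H^++\mathbb L_H^-$, and let $L_{H_D}$ and $\mathbb L_{H_D}$ be the Laplacian and signless Laplacian hypermatrices, respectively, of the underlying undirected hypergraph $H_D$ of $H$. Then $L_H$ and $L_{H_D}$ are isospectral, and $\mathbb L_H$ and $\mathbb L_{H_D}$ are isospectral.
   Context: $M_{m,n}$ is the set of real hypermatrices (tensors) $A=(a_{i_1i_2\dots i_m})$, $1\le i_1,\dots,i_m\le n$. For a vector $x$, $Ax^{m-1}$ is the vector with $i$-th entry $\sum_{i_2,\dots,i_m=1}^n a_{ii_2\dots i_m}x_{i_2}\cdots x_{i_m}$, and $x^{[m-1]}$ is the vector with $i$-th entry $x_i^{m-1}$. $\lambda\in\mathbb C$ is an eigenvalue of $A$ if $Ax^{m-1}=\lambda x^{[m-1]}$ for some $x\in\mathbb C^n\setminus\{0\}$. Two hypermatrices are isospectral if they have the same eigenvalues. A directed hypergraph $H=(V,E)$ has a finite vertex set $V=\{v_1,\dots,v_n\}$ and a set $E$ of edges; each edge $e$ is a subset of $V$ with a partition $e=T_e\sqcup H_e$ into a nonempty tail $T_e$ and a nonempty head $H_e$, and distinct edges $e_1\ne e_2$ satisfy $T_{e_1}\cup H_{e_1}\neq T_{e_2}\cup H_{e_2}$. It is $m$-uniform if $|e|=m$ for all $e\in E$. Out-degree: $d_v^+=|\{e\in E:v\in T_e\}|$; in-degree: $d_v^-=|\{e\in E:v\in H_e\}|$. The underlying undirected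 hypergraph $H_D=(V,E_D)$ has edge set $E_D=\{T_e\cup H_e: e\in E\}$. For a directed $m$-uniform hypergraph: Out-adjacency hypermatrix $A_H^+=(a^+_{i_1\dots i_m})\in M_{m,n}$: for each edge $e$ with $|T_e|=k$, $a^+_{i_1\dots i_m}=\frac{1}{(m-k)!\,(k-1)!}$ whenever $(v_{i_1},\dots,v_{i_k})$ is an ordering of all the elements of $T_e$ and $(v_{i_{k+1}},\dots,v_{i_m})$ is an ordering of all the elements of $H_e$; all other entries are $0$. In-adjacency hypermatrix $A_H^-=(a^-_{i_1\dots i_m})\in M_{m,n}$: for each edge $e$ with $|T_e|=k$, $a^-_{i_1\dots i_m}=\frac{1}{(m-k-1)!\,k!}$ whenever $(v_{i_1},\dots,v_{i_{m-k}})$ is an ordering of all the elements of $H_e$ and $(v_{i_{m-k+1}},\dots,v_{i_m})$ is an ordering of all the elements of $T_e$; all other entries are $0$. $D_H^{\pm}\in M_{m,n}$ is the diagonal hypermatrix with $(i,i,\dots,i)$ entry $d_{v_i}^{\pm}$ and all other entries $0$. $L_H^{\pm}=D_H^{\pm}-A_H^{\pm}$ (out-/in-Laplacian) and $\mathbb L_H^{\pm}=D_H^{\pm}+A_H^{\pm}$ (out-/in-signless Laplacian). For the undirected $m$-uniform hypergraph $H_D$: the adjacency tensor $A_{H_D}$ has $(i_1,\dots,i_m)$ entry $\frac1{(m-1)!}$ if $\{v_{i_1},\dots,v_{i_m}\}$ is an edge (with $i_1,\dots,i_m$ distinct), and $0$ otherwise; $D_{H_D}$ is the diagonal hypermatrix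 whose $(i,\dots,i)$ entry is the degree of $v_i$ (number of edges containing $v_i$); $L_{H_D}=D_{H_D}-A_{H_D}$ and $\mathbb L_{H_D}=D_{H_D}+A_{H_D}$. *)

theory Defs
  imports "HOL-Analysis.Analysis" "HOL-Combinatorics.Multiset_Permutations"
begin

text \<open>
  A hypermatrix of order \<open>m\<close> and dimension \<open>n = CARD('n)\<close> is a function on index lists; only its
  values on lists of length \<open>m\<close> are ever read.
\<close>

type_synonym 'n hypermatrix = "'n list \<Rightarrow> real"

definition hm_apply :: "nat \<Rightarrow> 'n::finite hypermatrix \<Rightarrow> complex ^ 'n \<Rightarrow> complex ^ 'n" where
  "hm_apply m A x =
     (\<chi> i. \<Sum>js\<in>{js. length js = m - 1}. complex_of_real (A (i # js)) * (\<Prod>j\<leftarrow>js. x $ j))"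

definition vec_power :: "complex ^ 'n \<Rightarrow> nat \<Rightarrow> complex ^ 'n::finite" where
  "vec_power x p = (\<chi> i. (x $ i) ^ p)"

definition hm_eigenvalue :: "nat \<Rightarrow> 'n::finite hypermatrix \<Rightarrow> complex \<Rightarrow> bool" where
  "hm_eigenvalue m A \<mu> \<longleftrightarrow>
     (\<exists>x :: complex ^ 'n. x \<noteq> 0 \<and> hm_apply m A x = \<mu> *s vec_power x (m - 1))"

definition isospectral :: "nat \<Rightarrow> 'n::finite hypermatrix \<Rightarrow> 'n hypermatrix \<Rightarrow> bool" where
  "isospectral m A B \<longleftrightarrow> {\<mu>. hm_eigenvalue m A \<mu>} = {\<mu>. hm_eigenvalue m B \<mu>}"

definition hm_diag :: "nat \<Rightarrow> ('n \<Rightarrow> real) \<Rightarrow> 'n hypermatrix" where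
  "hm_diag m d is = (if is = replicate m (hd is) then d (hd is) else 0)"

text \<open>An edge is the pair \<open>(T, H)\<close> of its tail and its head.\<close>

type_synonym 'v edge = "'v set \<times> 'v set"

locale directed_hypergraph =
  fixes V :: "'v set" and E :: "'v edge set"
  assumes finite_vertices: "finite V"
    and edge_subset: "(T, H) \<in> E \<Longrightarrow> T \<union> H \<subseteq> V"
    and tail_nonempty: "(T, H) \<in> E \<Longrightarrow> T \<noteq> {}"
    and head_nonempty: "(T, H) \<in> E \<Longrightarrow> H \<noteq> {}"
    and tail_head_disjoint: "(T, H) \<in> E \<Longrightarrow> T \<inter> H = {}"
    and distinct_edges: "e\<^sub>1 \<in> E \<Longrightarrow> e\<^sub>2 \<in> E \<Longrightarrow> e\<^sub>1 \<noteq> e\<^sub>2 \<Longrightarrow>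
      fst e\<^sub>1 \<union> snd e\<^sub>1 \<noteq> fst e\<^sub>2 \<union> snd e\<^sub>2"

definition uniform :: "nat \<Rightarrow> 'v edge set \<Rightarrow> bool" where
  "uniform m E \<longleftrightarrow> (\<forall>(T, H)\<in>E. card (T \<union> H) = m)"

definition out_degree :: "'v edge set \<Rightarrow> 'v \<Rightarrow> nat" where
  "out_degree E u = card {e \<in> E. u \<in> fst e}"

definition in_degree :: "'v edge set \<Rightarrow> 'v \<Rightarrow> nat" where
  "in_degree E u = card {e \<in> E. u \<in> snd e}"

definition underlying_edges :: "'v edge set \<Rightarrow> 'v set set" where
  "underlying_edges E = {T \<union> H | T H. (T, H) \<in> E}"

text \<open>
  Below, \<open>v :: 'n \<Rightarrow> 'v\<close> is the enumeration \<open>v\<^sub>1, \<dots>, v\<^sub>n\<close> of the vertices.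
  \<open>ordered_split v P Q is\<close>: the first \<open>|P|\<close> indices list all of \<open>P\<close> and the
  remaining ones list all of \<open>Q\<close>, each without repetition.
\<close>

definition ordered_split :: "('n \<Rightarrow> 'v) \<Rightarrow> 'v set \<Rightarrow> 'v set \<Rightarrow> 'n list \<Rightarrow> bool" where
  "ordered_split v P Q is \<longleftrightarrow>
     map v (take (card P) is) \<in> permutations_of_set P \<and>
     map v (drop (card P) is) \<in> permutations_of_set Q"

text \<open>
  An index list determines the union \<open>T \<union> H\<close>, so in a directed hypergraph at most one edge fits it
  and the description operator below is well-defined.
\<close>

definition out_adjacency :: "('n \<Rightarrow> 'v) \<Rightarrow> 'v edge set \<Rightarrow> nat \<Rightarrow> 'n hypermatrix" where
  "out_adjacency v E m is =
     (if \<exists>e\<in>E. ordered_split v (fst e) (snd e) is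
      then let k = card (fst (THE e. e \<in> E \<and> ordered_split v (fst e) (snd e) is))
           in 1 / (fact (m - k) * fact (k - 1))
      else 0)"

definition in_adjacency :: "('n \<Rightarrow> 'v) \<Rightarrow> 'v edge set \<Rightarrow> nat \<Rightarrow> 'n hypermatrix" where
  "in_adjacency v E m is =
     (if \<exists>e\<in>E. ordered_split v (snd e) (fst e) is
      then let k = card (fst (THE e. e \<in> E \<and> ordered_split v (snd e) (fst e) is))
           in 1 / (fact (m - k - 1) * fact k)
      else 0)"

definition out_degree_hm :: "('n \<Rightarrow> 'v) \<Rightarrow> 'v edge set \<Rightarrow> nat \<Rightarrow> 'n hypermatrix" where
  "out_degree_hm v E m = hm_diag m (\<lambda>i. real (out_degree E (v i)))"

definition in_degree_hm :: "('n \<Rightarrow> 'v) \<Rightarrow> 'v edge set \<Rightarrow> nat \<Rightarrow> 'n hypermatrix" where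
  "in_degree_hm v E m = hm_diag m (\<lambda>i. real (in_degree E (v i)))"

definition out_laplacian :: "('n \<Rightarrow> 'v) \<Rightarrow> 'v edge set \<Rightarrow> nat \<Rightarrow> 'n hypermatrix" where
  "out_laplacian v E m is = out_degree_hm v E m is - out_adjacency v E m is"

definition in_laplacian :: "('n \<Rightarrow> 'v) \<Rightarrow> 'v edge set \<Rightarrow> nat \<Rightarrow> 'n hypermatrix" where
  "in_laplacian v E m is = in_degree_hm v E m is - in_adjacency v E m is"

definition out_signless_laplacian :: "('n \<Rightarrow> 'v) \<Rightarrow> 'v edge set \<Rightarrow> nat \<Rightarrow> 'n hypermatrix" where
  "out_signless_laplacian v E m is = out_degree_hm v E m is + out_adjacency v E m is"

definition in_signless_laplacian :: "('n \<Rightarrow> 'v) \<Rightarrow> 'v edge set \<Rightarrow> nat \<Rightarrow> 'n hypermatrix" where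
  "in_signless_laplacian v E m is = in_degree_hm v E m is + in_adjacency v E m is"

definition laplacian :: "('n \<Rightarrow> 'v) \<Rightarrow> 'v edge set \<Rightarrow> nat \<Rightarrow> 'n hypermatrix" where
  "laplacian v E m is = out_laplacian v E m is + in_laplacian v E m is"

definition signless_laplacian :: "('n \<Rightarrow> 'v) \<Rightarrow> 'v edge set \<Rightarrow> nat \<Rightarrow> 'n hypermatrix" where
  "signless_laplacian v E m is = out_signless_laplacian v E m is + in_signless_laplacian v E m is"

text \<open>The undirected notions, for a set \<open>F\<close> of edges that are plain vertex sets.\<close>

definition undirected_degree :: "'v set set \<Rightarrow> 'v \<Rightarrow> nat" where
  "undirected_degree F u = card {e \<in> F. u \<in> e}"

definition undirected_adjacency :: "('n \<Rightarrow> 'v) \<Rightarrow> 'v set set \<Rightarrow> nat \<Rightarrow> 'n hypermatrix" where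
  "undirected_adjacency v F m is =
     (if distinct is \<and> v ` set is \<in> F then 1 / fact (m - 1) else 0)"

definition undirected_degree_hm :: "('n \<Rightarrow> 'v) \<Rightarrow> 'v set set \<Rightarrow> nat \<Rightarrow> 'n hypermatrix" where
  "undirected_degree_hm v F m = hm_diag m (\<lambda>i. real (undirected_degree F (v i)))"

definition undirected_laplacian :: "('n \<Rightarrow> 'v) \<Rightarrow> 'v set set \<Rightarrow> nat \<Rightarrow> 'n hypermatrix" where
  "undirected_laplacian v F m is = undirected_degree_hm v F m is - undirected_adjacency v F m is"

definition undirected_signless_laplacian :: "('n \<Rightarrow> 'v) \<Rightarrow> 'v set set \<Rightarrow> nat \<Rightarrow> 'n hypermatrix" where
  "undirected_signless_laplacian v F m is =
     undirected_degree_hm v F m is + undirected_adjacency v F m is"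

context directed_hypergraph
begin

lemma ordered_split_set:
  assumes "ordered_split v P Q is"
  shows "v ` set is = P \<union> Q"
proof -
  have "v ` set is = v ` set (take (card P) is) \<union> v ` set (drop (card P) is)"
    by (metis append_take_drop_id image_Un set_append)
  then show ?thesis
    using assms by (simp add: ordered_split_def permutations_of_set_def)
qed

lemma out_adjacency_edge:
  assumes "(T, H) \<in> E" "ordered_split v T H is"
  shows "out_adjacency v E m is = 1 / (fact (m - card T) * fact (card T - 1))"
proof -
  have unique: "e = (T, H)" if "e \<in> E" "ordered_split v (fst e) (snd e) is" for e
    using distinct_edges[OF that(1) assms(1)] ordered_split_set[OF that(2)]
      ordered_split_set[OF assms(2)] by auto
  have "(THE e. e \<in> E \<and> ordered_split v (fst e) (snd e) is) = (T, H)"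
    using assms by (intro the_equality conjI) (simp_all only: fst_conv snd_conv, blast intro: unique)
  moreover have "\<exists>e\<in>E. ordered_split v (fst e) (snd e) is"
    using assms by (intro bexI[of _ "(T, H)"]) simp_all
  ultimately show ?thesis
    by (simp add: out_adjacency_def Let_def)
qed

lemma in_adjacency_edge:
  assumes "(T, H) \<in> E" "ordered_split v H T is"
  shows "in_adjacency v E m is = 1 / (fact (m - card T - 1) * fact (card T))"
proof -
  have unique: "e = (T, H)" if "e \<in> E" "ordered_split v (snd e) (fst e) is" for e
    using distinct_edges[OF that(1) assms(1)] ordered_split_set[OF that(2)]
      ordered_split_set[OF assms(2)] by auto
  have "(THE e. e \<in> E \<and> ordered_split v (snd e) (fst e) is) = (T, H)"
    using assms by (intro the_equality conjI) (simp_all only: fst_conv snd_conv, blast intro: unique)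
  moreover have "\<exists>e\<in>E. ordered_split v (snd e) (fst e) is"
    using assms by (intro bexI[of _ "(T, H)"]) simp_all
  ultimately show ?thesis
    by (simp add: in_adjacency_def Let_def)
qed

end

end

theory Submission
  imports Defs
begin

text \<open>
  The hypermatrices \<open>L\<^sub>H\<close> and \<open>L\<^sub>D\<close> of the directed hypergraph and of its underlying undirected
  hypergraph are in general different, but they induce the same map \<open>x \<mapsto> A x\<^sup>m\<^sup>-\<^sup>1\<close>, and eigenvalues
  depend on this map alone; the same holds for the signless versions.

  For the diagonal parts, an edge contains a vertex in exactly one of its tail and its head, so the
  degrees add up: \<open>d\<^sup>+ + d\<^sup>- = d\<close>.

  For the adjacency parts, all three hypermatrices are sums over the edges of one kind of building
  block. Given disjoint vertex sets \<open>P\<close> and \<open>Q\<close>, the block \<open>split_hm v P Q\<close> lives on the index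
  lists that enumerate first \<open>P\<close> and then \<open>Q\<close>. An edge with tail \<open>T\<close> and head \<open>H\<close> contributes the
  block of \<open>(T, H)\<close> to the out-adjacency, of \<open>(H, T)\<close> to the in-adjacency, and of \<open>(T \<union> H, \<emptyset>)\<close> to
  the undirected adjacency. Row \<open>i\<close> of a block is supported on \<open>(|P| - 1)! |Q|!\<close> lists if \<open>v\<^sub>i \<in> P\<close>
  and vanishes otherwise. On each of these lists the monomial is the product of the variables of
  \<open>(P \<union> Q) - {v\<^sub>i}\<close>, since it does not see the order of its factors, and the weight of the block is
  the reciprocal of their number. Hence the block yields that monomial exactly when \<open>v\<^sub>i \<in> P\<close>
  (lemma \<open>hm_apply_split_hm\<close>). Since \<open>T\<close> and \<open>H\<close> partition \<open>T \<union> H\<close>, the blocks of \<open>(T, H)\<close> and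
  \<open>(H, T)\<close> together induce the same map as the block of \<open>(T \<union> H, \<emptyset>)\<close>.
\<close>

section \<open>Hypermatrices as polynomial maps\<close>

lemma hm_apply_add:
  "hm_apply m (\<lambda>is. A is + B is) x = hm_apply m A x + hm_apply m B x"
  by (simp add: hm_apply_def vec_eq_iff distrib_right sum.distrib)

lemma hm_apply_diff:
  "hm_apply m (\<lambda>is. A is - B is) x = hm_apply m A x - hm_apply m B x"
  by (simp add: hm_apply_def vec_eq_iff left_diff_distrib sum_subtractf)

lemma hm_apply_sum:
  "hm_apply m (\<lambda>is. \<Sum>e\<in>F. A e is) x = (\<Sum>e\<in>F. hm_apply m (A e) x)"
  by (simp add: hm_apply_def vec_eq_iff sum_distrib_right sum_component) (intro allI sum.swap)

lemma isospectral_if_hm_apply_eq: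
  assumes "\<And>x. hm_apply m A x = hm_apply m B x"
  shows "isospectral m A B"
  using assms by (simp add: isospectral_def hm_eigenvalue_def)

section \<open>The block of a pair of vertex sets\<close>

text \<open>
  The weight is the reciprocal of the number of lists in the support that start with a given index
  of \<open>P\<close>. It agrees with the weights \<open>1 / ((m - k)! (k - 1)!)\<close> and \<open>1 / ((m - k - 1)! k!)\<close> of an
  edge of size \<open>m\<close> with tail of size \<open>k\<close>, and for empty \<open>Q\<close> with the undirected weight
  \<open>1 / (m - 1)!\<close>.
\<close>

definition split_hm :: "('n \<Rightarrow> 'v) \<Rightarrow> 'v set \<Rightarrow> 'v set \<Rightarrow> 'n hypermatrix" where
  "split_hm v P Q is =
     (if ordered_split v P Q is then 1 / (fact (card P - 1) * fact (card Q)) else 0)"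

text \<open>
  The first index is used up by \<open>P\<close>, so the rest of the list is a split of \<open>P - {v i}\<close> and \<open>Q\<close>.
  If \<open>P\<close> were empty, the first index would come from \<open>Q\<close> instead.
\<close>

lemma ordered_split_Cons_iff:
  assumes "finite P" "P \<noteq> {}"
  shows "ordered_split v P Q (i # js) \<longleftrightarrow>
    v i \<in> P \<and> map v (take (card P - 1) js) \<in> permutations_of_set (P - {v i}) \<and>
    map v (drop (card P - 1) js) \<in> permutations_of_set Q"
proof -
  obtain p where "card P = Suc p"
    using assms by (metis card_eq_0_iff not0_implies_Suc)
  moreover have "y # zs \<in> permutations_of_set P \<longleftrightarrow>
      y \<in> P \<and> zs \<in> permutations_of_set (P - {y})" for y zs
    by (auto simp: permutations_of_set_def)
  ultimately show ?thesis
    by (simp add: ordered_split_def)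
qed

text \<open>
  Such a list is a free choice of an ordering of \<open>P - {v i}\<close> and an ordering of \<open>Q\<close>.
\<close>

lemma card_ordered_split_Cons:
  assumes "inj v" "P \<subseteq> range v" "Q \<subseteq> range v" "finite P" "finite Q" "v i \<in> P"
  shows "card {js. ordered_split v P Q (i # js)} = fact (card P - 1) * fact (card Q)"
proof -
  let ?X = "permutations_of_set (P - {v i}) \<times> permutations_of_set Q"
  let ?Y = "{js. ordered_split v P Q (i # js)}"
  have card_P: "card (P - {v i}) = card P - 1"
    using assms by simp
  have length_fst: "length xs = card P - 1" if "xs \<in> permutations_of_set (P - {v i})" for xs
    using length_finite_permutations_of_set[OF that] card_P by simp
  have map_inv: "map v (map (inv v) zs) = zs" if "set zs \<subseteq> range v" for zs
    using that by (auto intro!: map_idI simp: f_inv_into_f)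
  have sets: "set xs \<subseteq> range v" "set ys \<subseteq> range v" if "(xs, ys) \<in> ?X" for xs ys
    using that assms by (auto dest!: permutations_of_setD(1))
  have "P \<noteq> {}"
    using assms by auto
  note split_iff = ordered_split_Cons_iff[OF \<open>finite P\<close> \<open>P \<noteq> {}\<close>]
  have "bij_betw (\<lambda>(xs, ys). map (inv v) (xs @ ys)) ?X ?Y"
  proof (rule bij_betw_byWitness[where
        f' = "\<lambda>js. (map v (take (card P - 1) js), map v (drop (card P - 1) js))"])
    show "\<forall>z\<in>?X. (\<lambda>js. (map v (take (card P - 1) js), map v (drop (card P - 1) js)))
        ((\<lambda>(xs, ys). map (inv v) (xs @ ys)) z) = z"
      using sets map_inv by (auto simp: length_fst simp del: map_map)
    show "\<forall>js\<in>?Y. (\<lambda>(xs, ys). map (inv v) (xs @ ys))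
        (map v (take (card P - 1) js), map v (drop (card P - 1) js)) = js"
      using \<open>inj v\<close> by (simp flip: map_append)
    show "(\<lambda>(xs, ys). map (inv v) (xs @ ys)) ` ?X \<subseteq> ?Y"
      using sets map_inv assms by (auto simp: split_iff length_fst simp del: map_map)
    show "(\<lambda>js. (map v (take (card P - 1) js), map v (drop (card P - 1) js))) ` ?Y \<subseteq> ?X"
      by (auto simp: split_iff)
  qed
  then have "card ?Y = card ?X"
    by (simp add: bij_betw_same_card)
  also have "\<dots> = fact (card P - 1) * fact (card Q)"
    using assms card_P by (simp add: card_cartesian_product)
  finally show ?thesis .
qed

lemma ordered_split_Cons_distinct_set:
  assumes "inj v" "finite P" "P \<noteq> {}" "P \<inter> Q = {}" "ordered_split v P Q (i # js)"
  shows "distinct js" "set js = v -` (P \<union> Q) - {i}"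
proof -
  let ?a = "map v (take (card P - 1) js)" and ?b = "map v (drop (card P - 1) js)"
  have i: "v i \<in> P" and a: "?a \<in> permutations_of_set (P - {v i})"
    and b: "?b \<in> permutations_of_set Q"
    using assms ordered_split_Cons_iff by metis+
  have js: "map v js = ?a @ ?b"
    by (simp flip: map_append)
  have "distinct (map v js)"
    unfolding js using assms permutations_of_setD[OF a] permutations_of_setD[OF b] by auto
  then show "distinct js"
    by (simp add: distinct_map)
  have "set (map v js) = (P \<union> Q) - {v i}"
    unfolding js using i assms permutations_of_setD[OF a] permutations_of_setD[OF b] by auto
  then have "v ` set js = (P \<union> Q) - {v i}"
    by simp
  then have "v -` (v ` set js) = v -` (P \<union> Q) - v -` {v i}"
    by auto
  moreover have "v -` {v i} = {i}"
    using \<open>inj v\<close> by (auto dest: injD)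
  ultimately show "set js = v -` (P \<union> Q) - {i}"
    using \<open>inj v\<close> by (simp add: inj_vimage_image_eq)
qed

text \<open>
  The number of index lists in row \<open>i\<close> of the support cancels against the weight, so what remains
  does not depend on how an edge is divided into \<open>P\<close> and \<open>Q\<close>, except for the condition on \<open>v i\<close>.
\<close>

lemma hm_apply_split_hm:
  fixes v :: "'n::finite \<Rightarrow> 'v"
  assumes "inj v" "P \<subseteq> range v" "Q \<subseteq> range v" "P \<noteq> {}" "P \<inter> Q = {}" "card (P \<union> Q) = m"
  shows "hm_apply m (split_hm v P Q) x $ i =
    (if v i \<in> P then \<Prod>j\<in>v -` (P \<union> Q) - {i}. x $ j else 0)"
proof -
  have fin: "finite P" "finite Q"
    using assms(2,3) by (auto intro: finite_subset[of _ "range v"])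
  let ?S = "{js. ordered_split v P Q (i # js)}"
  let ?w = "1 / (fact (card P - 1) * fact (card Q)) :: complex"
  let ?mon = "\<Prod>j\<in>v -` (P \<union> Q) - {i}. x $ j"
  note split_iff = ordered_split_Cons_iff[OF fin(1) \<open>P \<noteq> {}\<close>]
  note split = ordered_split_Cons_distinct_set[OF \<open>inj v\<close> fin(1) \<open>P \<noteq> {}\<close> \<open>P \<inter> Q = {}\<close>]
  have S_length: "length js = m - 1" if "js \<in> ?S" for js
  proof -
    have js: "ordered_split v P Q (i # js)"
      using that by simp
    then have "v i \<in> P"
      by (simp add: split_iff)
    have "length js = card (v -` (P \<union> Q) - {i})"
      using split[OF js] by (metis distinct_card)
    also have "\<dots> = card (v -` (P \<union> Q)) - 1"
      using \<open>v i \<in> P\<close> by simp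
    also have "card (v -` (P \<union> Q)) = m"
      using assms by (subst card_vimage_inj) auto
    finally show ?thesis .
  qed
  have S_prod: "(\<Prod>j\<leftarrow>js. x $ j) = ?mon" if "js \<in> ?S" for js
    using split[of i js] that prod.distinct_set_conv_list[of js "($) x"] by simp
  have "hm_apply m (split_hm v P Q) x $ i =
      (\<Sum>js | length js = m - 1. if js \<in> ?S then ?w * (\<Prod>j\<leftarrow>js. x $ j) else 0)"
    by (auto simp: hm_apply_def split_hm_def intro!: sum.cong)
  also have "\<dots> = (\<Sum>js\<in>?S. ?w * (\<Prod>j\<leftarrow>js. x $ j))"
    using S_length finite_lists_length_eq[of "UNIV :: 'n set" "m - 1"]
    by (intro sum.mono_neutral_cong_right) auto
  also have "\<dots> = of_nat (card ?S) * (?w * ?mon)"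
    using S_prod by simp
  also have "\<dots> = (if v i \<in> P then ?mon else 0)"
  proof (cases "v i \<in> P")
    case True
    then show ?thesis
      using card_ordered_split_Cons[OF assms(1-3) fin True] by simp
  next
    case False
    then show ?thesis
      by (simp add: split_iff)
  qed
  finally show ?thesis .
qed

section \<open>Degrees and adjacency of a uniform directed hypergraph\<close>

lemma hm_diag_add: "hm_diag m (\<lambda>i. c i + d i) is = hm_diag m c is + hm_diag m d is"
  by (simp add: hm_diag_def)

lemma sum_if_unique:
  fixes c :: "'e \<Rightarrow> real"
  assumes "finite E" "e \<in> E" "p e" "\<And>e'. e' \<in> E \<Longrightarrow> p e' \<Longrightarrow> e' = e"
  shows "(\<Sum>e\<in>E. if p e then c e else 0) = c e"
proof -
  have "(\<Sum>e\<in>E. if p e then c e else 0) = (\<Sum>e'\<in>E. if e' = e then c e' else 0)"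
    by (intro sum.cong refl) (metis assms(3,4))
  then show ?thesis
    using assms(1,2) by simp
qed

text \<open>
  This makes the undirected adjacency condition the special case \<open>Q = \<emptyset>\<close> of a split.
\<close>

lemma ordered_split_empty_iff:
  assumes "inj v" "finite S"
  shows "ordered_split v S {} is \<longleftrightarrow> distinct is \<and> v ` set is = S"
proof
  assume "ordered_split v S {} is"
  then show "distinct is \<and> v ` set is = S"
    by (auto simp: ordered_split_def permutations_of_set_def distinct_map)
next
  assume "distinct is \<and> v ` set is = S"
  moreover from this have "length is = card S"
    using assms by (metis card_image distinct_card inj_on_subset subset_UNIV)
  ultimately show "ordered_split v S {} is"
    using assms by (auto simp: ordered_split_def permutations_of_set_def distinct_map
        intro: inj_on_subset)
qed

context directed_hypergraph
begin

lemma finite_edges: "finite E"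
proof (rule finite_subset)
  show "E \<subseteq> Pow V \<times> Pow V"
    by (auto dest!: edge_subset)
  show "finite (Pow V \<times> Pow V)"
    by (simp add: finite_vertices)
qed

lemma edge_eqI:
  assumes "e \<in> E" "e' \<in> E" "fst e \<union> snd e = fst e' \<union> snd e'"
  shows "e = e'"
  using assms distinct_edges by blast

lemma inj_on_edge_union: "inj_on (\<lambda>e. fst e \<union> snd e) E"
  by (rule inj_onI) (rule edge_eqI)

lemma underlying_edges_eq_image: "underlying_edges E = (\<lambda>e. fst e \<union> snd e) ` E"
  by (simp add: underlying_edges_def image_def Bex_def conj_commute)

lemma
  assumes "e \<in> E"
  shows finite_tail: "finite (fst e)" and finite_head: "finite (snd e)"
    and tail_Int_head: "fst e \<inter> snd e = {}"
proof -
  have e: "(fst e, snd e) \<in> E"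
    using assms by simp
  show "finite (fst e)" "finite (snd e)"
    using edge_subset[OF e] by (auto intro: finite_subset[OF _ finite_vertices])
  show "fst e \<inter> snd e = {}"
    by (rule tail_head_disjoint[OF e])
qed

lemma card_tail_add_card_head:
  assumes "uniform m E" "e \<in> E"
  shows "card (fst e) + card (snd e) = m"
proof -
  have "card (fst e \<union> snd e) = m"
    using assms by (auto simp: uniform_def split_def)
  then show ?thesis
    using assms(2) by (simp add: card_Un_disjoint finite_tail finite_head tail_Int_head)
qed

lemma out_degree_add_in_degree:
  "out_degree E u + in_degree E u = undirected_degree (underlying_edges E) u"
proof -
  have "{s \<in> underlying_edges E. u \<in> s} = (\<lambda>e. fst e \<union> snd e) ` {e \<in> E. u \<in> fst e \<union> snd e}"
    by (auto simp: underlying_edges_eq_image)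
  then have "undirected_degree (underlying_edges E) u = card {e \<in> E. u \<in> fst e \<union> snd e}"
    using inj_on_subset[OF inj_on_edge_union]
    by (auto simp: undirected_degree_def intro!: card_image)
  also have "{e \<in> E. u \<in> fst e \<union> snd e} = {e \<in> E. u \<in> fst e} \<union> {e \<in> E. u \<in> snd e}"
    by auto
  also have "card \<dots> = out_degree E u + in_degree E u"
    unfolding out_degree_def in_degree_def
    using finite_edges tail_Int_head by (intro card_Un_disjoint) auto
  finally show ?thesis ..
qed

text \<open>
  An index list determines the vertex set that it enumerates, and distinct edges have distinct
  vertex sets. So at most one block of the sum is nonzero at a given list, namely that of the edge
  which the definition of the adjacency hypermatrix selects there.
\<close>

lemma out_adjacency_eq_sum:
  assumes "uniform m E"
  shows "out_adjacency v E m is = (\<Sum>e\<in>E. split_hm v (fst e) (snd e) is)"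
proof (cases "\<exists>e\<in>E. ordered_split v (fst e) (snd e) is")
  case True
  then obtain e where e: "e \<in> E" "ordered_split v (fst e) (snd e) is"
    by auto
  have "out_adjacency v E m is = 1 / (fact (m - card (fst e)) * fact (card (fst e) - 1))"
    using out_adjacency_edge[of "fst e" "snd e"] e by simp
  also have "\<dots> = 1 / (fact (card (fst e) - 1) * fact (card (snd e)))"
    using card_tail_add_card_head[OF assms e(1)] by auto
  also have "\<dots> = (\<Sum>e\<in>E. split_hm v (fst e) (snd e) is)"
    unfolding split_hm_def
    using e by (intro sum_if_unique[symmetric] finite_edges)
      (auto intro!: edge_eqI dest!: ordered_split_set)
  finally show ?thesis .
qed (auto simp: out_adjacency_def split_hm_def)

lemma in_adjacency_eq_sum:
  assumes "uniform m E"
  shows "in_adjacency v E m is = (\<Sum>e\<in>E. split_hm v (snd e) (fst e) is)"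
proof (cases "\<exists>e\<in>E. ordered_split v (snd e) (fst e) is")
  case True
  then obtain e where e: "e \<in> E" "ordered_split v (snd e) (fst e) is"
    by auto
  have "in_adjacency v E m is = 1 / (fact (m - card (fst e) - 1) * fact (card (fst e)))"
    using in_adjacency_edge[of "fst e" "snd e"] e by simp
  also have "\<dots> = 1 / (fact (card (snd e) - 1) * fact (card (fst e)))"
    using card_tail_add_card_head[OF assms e(1)] by auto
  also have "\<dots> = (\<Sum>e\<in>E. split_hm v (snd e) (fst e) is)"
    unfolding split_hm_def
    using e by (intro sum_if_unique[symmetric] finite_edges)
      (auto intro!: edge_eqI dest!: ordered_split_set)
  finally show ?thesis .
qed (auto simp: in_adjacency_def split_hm_def)

lemma undirected_adjacency_eq_sum:
  assumes "uniform m E" "inj v"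
  shows "undirected_adjacency v (underlying_edges E) m is =
    (\<Sum>e\<in>E. split_hm v (fst e \<union> snd e) {} is)"
proof -
  have split_iff: "ordered_split v (fst e \<union> snd e) {} is \<longleftrightarrow>
      distinct is \<and> v ` set is = fst e \<union> snd e" if "e \<in> E" for e
    using that assms(2) by (simp add: ordered_split_empty_iff finite_tail finite_head)
  show ?thesis
  proof (cases "\<exists>e\<in>E. ordered_split v (fst e \<union> snd e) {} is")
    case True
    then obtain e where e: "e \<in> E" "ordered_split v (fst e \<union> snd e) {} is"
      by auto
    have "undirected_adjacency v (underlying_edges E) m is = 1 / fact (m - 1)"
      using e split_iff by (auto simp: undirected_adjacency_def underlying_edges_eq_image)
    also have "\<dots> = 1 / (fact (card (fst e \<union> snd e) - 1) * fact (card ({} :: 'v set)))"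
      using card_tail_add_card_head[OF assms(1) e(1)] e(1)
      by (simp add: card_Un_disjoint finite_tail finite_head tail_Int_head)
    also have "\<dots> = (\<Sum>e\<in>E. split_hm v (fst e \<union> snd e) {} is)"
      unfolding split_hm_def
      using e by (intro sum_if_unique[symmetric] finite_edges)
        (auto intro!: edge_eqI simp: split_iff)
    finally show ?thesis .
  next
    case False
    then show ?thesis
      using split_iff
      by (auto simp: undirected_adjacency_def split_hm_def underlying_edges_eq_image)
  qed
qed

text \<open>
  The polynomial maps agree, although the hypermatrices do not: for an edge, the undirected
  adjacency spreads the same total weight over all orderings of the remaining vertices that the
  directed ones put on those orderings compatible with the partition into tail and head.
\<close>

lemma hm_apply_adjacency:
  fixes v :: "'n::finite \<Rightarrow> 'v"
  assumes "uniform m E" "bij_betw v UNIV V"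
  shows "hm_apply m (out_adjacency v E m) x + hm_apply m (in_adjacency v E m) x =
    hm_apply m (undirected_adjacency v (underlying_edges E) m) x"
proof -
  have v: "inj v" "range v = V"
    using assms(2) by (auto simp: bij_betw_def)
  have edge: "hm_apply m (split_hm v (fst e) (snd e)) x + hm_apply m (split_hm v (snd e) (fst e)) x
      = hm_apply m (split_hm v (fst e \<union> snd e) {}) x" if "e \<in> E" for e
  proof -
    have "(fst e, snd e) \<in> E"
      using that by simp
    note e = edge_subset[OF this] tail_nonempty[OF this] head_nonempty[OF this]
      tail_head_disjoint[OF this]
    have "card (fst e \<union> snd e) = m"
      using assms(1) that by (auto simp: uniform_def split_def)
    then show ?thesis
      using e v by (auto simp: vec_eq_iff hm_apply_split_hm Un_commute Int_commute)
  qed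
  have "hm_apply m (out_adjacency v E m) x + hm_apply m (in_adjacency v E m) x =
      (\<Sum>e\<in>E. hm_apply m (split_hm v (fst e) (snd e)) x + hm_apply m (split_hm v (snd e) (fst e)) x)"
    unfolding out_adjacency_eq_sum[OF assms(1), abs_def] in_adjacency_eq_sum[OF assms(1), abs_def]
    by (simp add: hm_apply_sum sum.distrib)
  also have "\<dots> = (\<Sum>e\<in>E. hm_apply m (split_hm v (fst e \<union> snd e) {}) x)"
    by (rule sum.cong[OF refl edge])
  also have "\<dots> = hm_apply m (undirected_adjacency v (underlying_edges E) m) x"
    unfolding undirected_adjacency_eq_sum[OF assms(1) v(1), abs_def]
    by (simp add: hm_apply_sum)
  finally show ?thesis .
qed

lemma hm_apply_degree:
  "hm_apply m (out_degree_hm v E m) x + hm_apply m (in_degree_hm v E m) x =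
    hm_apply m (undirected_degree_hm v (underlying_edges E) m) x"
proof -
  have "undirected_degree_hm v (underlying_edges E) m =
      (\<lambda>is. out_degree_hm v E m is + in_degree_hm v E m is)"
    by (simp add: fun_eq_iff undirected_degree_hm_def out_degree_hm_def in_degree_hm_def
        hm_diag_add flip: out_degree_add_in_degree)
  then show ?thesis
    by (simp add: hm_apply_add)
qed

end

theorem theorem13:
  fixes V :: "'v set" and E :: "'v edge set" and v :: "'n::finite \<Rightarrow> 'v" and m :: nat
  assumes "directed_hypergraph V E"
    and "uniform m E"
    and "bij_betw v UNIV V"
  shows "isospectral m (laplacian v E m) (undirected_laplacian v (underlying_edges E) m) \<and>
    isospectral m (signless_laplacian v E m)
      (undirected_signless_laplacian v (underlying_edges E) m)"
proof -
  interpret directed_hypergraph V E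
    by (rule assms(1))
  note adjacency = hm_apply_adjacency[OF assms(2,3), symmetric]
  note degree = hm_apply_degree[symmetric]
  have "hm_apply m (laplacian v E m) x =
      hm_apply m (undirected_laplacian v (underlying_edges E) m) x" for x
    unfolding laplacian_def[abs_def] out_laplacian_def in_laplacian_def
      undirected_laplacian_def[abs_def]
    by (simp add: hm_apply_add hm_apply_diff adjacency degree)
  moreover have "hm_apply m (signless_laplacian v E m) x =
      hm_apply m (undirected_signless_laplacian v (underlying_edges E) m) x" for x
    unfolding signless_laplacian_def[abs_def] out_signless_laplacian_def
      in_signless_laplacian_def undirected_signless_laplacian_def[abs_def]
    by (simp add: hm_apply_add adjacency degree)
  ultimately show ?thesis
    by (simp add: isospectral_if_hm_apply_eq)
qed

end
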